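(* Let $n$ be an odd positive integer and let $X = (\mathbb{Z}_n, S)$ be the unitary Cayley graph on $\mathbb{Z}_n$. Then there is no quantum fractional revival in $X$: there do not exist distinct vertices $u, v$ of $X$, a time $t > 0$, and complex numbers $\alpha, \beta$ with $|\alpha|^2 + |\beta|^2 = 1$ such that $U(t) e_u = \alpha e_u + \beta e_v$.
   Context: The unitary Cayley graph $X=(\mathbb{Z}_n,S)$ is the simple graph with vertex set the additive cyclic group $\mathbb{Z}_n$, in which two distinct vertices $a, b$ are adjacent if and only if $a-b \in S$, where $S=\{s\in \mathbb{Z}_n : \gcd(s,n)=1\}$. Let $A$ be its adjacency matrix, with rows and columns indexed by $\mathbb{Z}_n$. The evolution operator of the continuous time quantum walk on $X$ is the unitary matrix $U(t) = e^{-iAt}$, and $e_a$ denotes the standard basis vector of $\mathbb{C}^n$ indexed by the vertex $a$. Quantum fractional revival occurs between vertices $u$ and $v$ at time $t$ if $U(t) e_u = \alpha e_u + \beta e_v$ for some complex numbers $\alpha,\beta$ with $|\alpha|^2+|\beta|^2=1$.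
   Formalization: The formal statement additionally requires β ≠ 0; without it the claim fails for every odd n ≥ 3, since the eigenvalues are integers, so U(2π) = I and U(2π)e_u = 1·e_u + 0·e_v (for example n = 3). *)

theory Defs
  imports Complex_Main "Jordan_Normal_Form.Jordan_Normal_Form"
begin

text \<open>Elements of \<open>\<int>\<^sub>n\<close> are the residues \<open>0, \<dots>, n - 1\<close>. Vertices are taken as natural numbers
  below \<open>n\<close>, so that they can index matrices; differences are formed in the integers and reduced
  modulo \<open>n\<close>, because subtraction on \<open>nat\<close> truncates.\<close>

definition unit_residues :: "nat \<Rightarrow> int set" where
  "unit_residues n = {s \<in> {0..<int n}. gcd s (int n) = 1}"

definition unitary_cayley_adj :: "nat \<Rightarrow> nat \<Rightarrow> nat \<Rightarrow> bool" where
  "unitary_cayley_adj n a b \<longleftrightarrow> a \<noteq> b \<and> (int a - int b) mod int n \<in> unit_residues n"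

definition unitary_cayley_matrix :: "nat \<Rightarrow> complex mat" where
  "unitary_cayley_matrix n = mat n n (\<lambda>(a, b). if unitary_cayley_adj n a b then 1 else 0)"

text \<open>The exponential series of a square matrix, summed entrywise; \<open>mat_exp_sums\<close> shows that every
  one of these series converges.\<close>

definition mat_exp :: "complex mat \<Rightarrow> complex mat" where
  "mat_exp M = mat (dim_row M) (dim_row M) (\<lambda>(i, j). \<Sum>k. (M ^\<^sub>m k) $$ (i, j) / fact k)"

lemma norm_bound_pow_mat:
  assumes "M \<in> carrier_mat n n" "norm_bound M b"
  shows "norm_bound (M ^\<^sub>m k) ((b * of_nat n) ^ k)"
proof (induction k)
  case 0
  then show ?case by (auto simp: norm_bound_def one_mat_def)
next
  case (Suc k)
  have "norm_bound (M ^\<^sub>m k * M) ((b * of_nat n) ^ k * b * of_nat n)"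
    by (rule norm_bound_mult[OF pow_carrier_mat[OF assms(1)] assms(1) Suc assms(2)])
  then show ?case by (simp add: mult_ac)
qed

lemma mat_exp_sums:
  assumes M: "M \<in> carrier_mat n n" and ij: "i < n" "j < n"
  shows "(\<lambda>k. (M ^\<^sub>m k) $$ (i, j) / fact k) sums (mat_exp M $$ (i, j))"
proof -
  obtain b where b: "norm_bound M b" using norm_bound_max by blast
  have "summable (\<lambda>k. (M ^\<^sub>m k) $$ (i, j) / fact k)"
  proof (rule summable_comparison_test)
    show "\<exists>N. \<forall>k\<ge>N. norm ((M ^\<^sub>m k) $$ (i, j) / fact k) \<le> inverse (fact k) * (b * of_nat n) ^ k"
      using norm_bound_pow_mat[OF M b] M ij
      by (auto simp: norm_bound_def norm_divide divide_simps pow_mat_dim_square[OF M])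
    show "summable (\<lambda>k. inverse (fact k) * (b * of_nat n) ^ k)" by (rule summable_exp)
  qed
  then show ?thesis using M ij by (simp add: mat_exp_def summable_sums)
qed

definition evolution :: "nat \<Rightarrow> real \<Rightarrow> complex mat" where
  "evolution n t = mat_exp ((- \<i> * complex_of_real t) \<cdot>\<^sub>m unitary_cayley_matrix n)"

text \<open>The condition \<open>\<beta> \<noteq> 0\<close> is the usual convention for fractional revival between two vertices.
  With \<open>\<beta> = 0\<close> the equation says only that the walk is periodic at \<open>u\<close>, whatever \<open>v\<close> is, and
  this happens in every unitary Cayley graph at time \<open>2\<pi>\<close>, since the eigenvalues are integers.
  The case \<open>\<alpha> = 0\<close>, perfect state transfer, is included.\<close>

definition fractional_revival :: "nat \<Rightarrow> nat \<Rightarrow> nat \<Rightarrow> real \<Rightarrow> bool" where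
  "fractional_revival n u v t \<longleftrightarrow>
     (\<exists>\<alpha> \<beta> :: complex. (cmod \<alpha>)\<^sup>2 + (cmod \<beta>)\<^sup>2 = 1 \<and> \<beta> \<noteq> 0 \<and>
        evolution n t *\<^sub>v unit_vec n u = \<alpha> \<cdot>\<^sub>v unit_vec n u + \<beta> \<cdot>\<^sub>v unit_vec n v)"

end

theory Submission
  imports Defs
begin

text \<open>The reflection \<open>x \<mapsto> 2u - x\<close> is an automorphism of the graph, so \<open>U(t)\<close> commutes with it. As \<open>n\<close>
  is odd, its only fixed vertex is \<open>u\<close>, hence \<open>U(t) e\<^sub>u\<close> has the same entry at \<open>v\<close> and at the
  vertex \<open>2u - v\<close>, which is different from both \<open>u\<close> and \<open>v\<close>. If \<open>U(t) e\<^sub>u\<close> is supported on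
  \<open>{u, v}\<close>, this common entry vanishes.\<close>

text \<open>The summand \<open>n - x\<close> stands for \<open>- x\<close> modulo \<open>n\<close>:
  for \<open>x < n\<close> the subtraction on \<open>nat\<close> does not truncate.\<close>

definition reflection :: "nat \<Rightarrow> nat \<Rightarrow> nat \<Rightarrow> nat" where
  "reflection n u x = (2 * u + (n - x)) mod n"

lemma reflection_less: "0 < n \<Longrightarrow> reflection n u x < n"
  by (simp add: reflection_def)

lemma int_reflection:
  assumes "x < n"
  shows "int (reflection n u x) = (2 * int u - int x) mod int n"
proof -
  have "int (reflection n u x) = (2 * int u + (int n - int x)) mod int n"
    using assms by (simp add: reflection_def zmod_int of_nat_diff algebra_simps)
  also have "\<dots> = (2 * int u - int x + int n) mod int n"
    by (simp add: algebra_simps)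
  finally show ?thesis by simp
qed

lemma reflection_reflection:
  assumes "x < n"
  shows "reflection n u (reflection n u x) = x"
proof -
  have "int (reflection n u (reflection n u x)) = (2 * int u - (2 * int u - int x) mod int n) mod int n"
    using assms by (simp add: int_reflection reflection_less)
  also have "\<dots> = int x"
    using assms by (simp add: mod_diff_right_eq)
  finally show ?thesis by simp
qed

lemma bij_betw_reflection: "bij_betw (reflection n u) {0..<n} {0..<n}"
  by (rule bij_betw_byWitness[where f' = "reflection n u"])
    (auto simp: reflection_reflection reflection_less)

lemma reflection_center: "u < n \<Longrightarrow> reflection n u u = u"
  using int_reflection[of u n u] by simp

text \<open>A fixed vertex \<open>v\<close> satisfies 2(u - v) = 0 modulo \<open>n\<close>, and 2 is
  invertible modulo an odd \<open>n\<close>.\<close>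

lemma reflection_neq:
  assumes "odd n" "u < n" "v < n" "u \<noteq> v"
  shows "reflection n u v \<noteq> v"
proof
  assume "reflection n u v = v"
  then have "(2 * int u - int v) mod int n = int v mod int n"
    using int_reflection[OF assms(3), of u] assms(3) by simp
  then have "int n dvd 2 * (int u - int v)"
    by (simp add: mod_eq_dvd_iff algebra_simps)
  moreover have "coprime (int n) 2"
    using assms(1) by simp
  ultimately have "int n dvd int u - int v"
    using coprime_dvd_mult_right_iff by blast
  \<comment> \<open>The difference is nonzero and of absolute value below \<open>n\<close>, so
    \<open>n\<close> cannot divide it.\<close>
  then show False
    using assms dvd_imp_le_int[of "int u - int v" "int n"] by auto
qed

text \<open>Reduction modulo \<open>n\<close> does not change the gcd with \<open>n\<close>, and for
  \<open>n > 0\<close> the residue lies in the required range.\<close>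

lemma unitary_cayley_adj_iff:
  assumes "0 < n"
  shows "unitary_cayley_adj n a b \<longleftrightarrow> a \<noteq> b \<and> coprime (int a - int b) (int n)"
  using assms by (simp add: unitary_cayley_adj_def unit_residues_def coprime_iff_gcd_eq_1 gcd.commute)

text \<open>A reflection negates differences modulo \<open>n\<close>, and the set of units is closed
  under negation.\<close>

lemma unitary_cayley_adj_reflection:
  assumes "a < n" "b < n"
  shows "unitary_cayley_adj n (reflection n u a) (reflection n u b) \<longleftrightarrow> unitary_cayley_adj n a b"
proof -
  have n: "0 < n" using assms by simp
  have "(int (reflection n u a) - int (reflection n u b)) mod int n = (int b - int a) mod int n"
    using assms by (simp add: int_reflection mod_diff_eq)
  then have "coprime (int (reflection n u a) - int (reflection n u b)) (int n)
      \<longleftrightarrow> coprime (int b - int a) (int n)"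
    by (metis coprime_iff_gcd_eq_1 gcd_mod_left n of_nat_0_less_iff less_irrefl gcd.commute)
  also have "\<dots> \<longleftrightarrow> coprime (int a - int b) (int n)"
    by (metis coprime_minus_left_iff minus_diff_eq)
  \<comment> \<open>Distinctness of the two vertices is preserved because an involution is
    injective.\<close>
  finally show ?thesis
    using assms n by (metis unitary_cayley_adj_iff reflection_reflection)
qed

text \<open>In matrix terms, \<open>M\<close> commutes with the permutation matrix of
  \<open>f\<close>, hence so do its powers.\<close>

lemma pow_mat_bij_invariant:
  fixes M :: "'a::semiring_1 mat"
  assumes M: "M \<in> carrier_mat n n" and f: "bij_betw f {0..<n} {0..<n}"
    and inv: "\<And>i j. i < n \<Longrightarrow> j < n \<Longrightarrow> M $$ (f i, f j) = M $$ (i, j)"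
    and ij: "i < n" "j < n"
  shows "(M ^\<^sub>m k) $$ (f i, f j) = (M ^\<^sub>m k) $$ (i, j)"
proof -
  have f_less: "f i < n" if "i < n" for i
    using bij_betwE[OF f] that by simp
  have mult_entry: "(M ^\<^sub>m Suc k) $$ (i, j) = (\<Sum>l\<in>{0..<n}. (M ^\<^sub>m k) $$ (i, l) * M $$ (l, j))"
    if "i < n" "j < n" for i j k
    using M that by (simp add: pow_mat_dim_square[OF M] scalar_prod_def)
  show ?thesis
    using ij
  proof (induction k arbitrary: i j)
    case 0
    moreover have "f i = f j \<longleftrightarrow> i = j"
      using bij_betw_imp_inj_on[OF f] 0 by (auto simp: inj_on_def)
    ultimately show ?case using M f_less by simp
  next
    case (Suc k)
    have "(M ^\<^sub>m Suc k) $$ (f i, f j) = (\<Sum>l\<in>{0..<n}. (M ^\<^sub>m k) $$ (f i, l) * M $$ (l, f j))"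
      using Suc.prems f_less by (intro mult_entry)
    \<comment> \<open>Since \<open>f\<close> permutes the indices, the intermediate index may be
      taken of the form \<open>f l\<close>; both factors are then invariant.\<close>
    also have "\<dots> = (\<Sum>l\<in>{0..<n}. (M ^\<^sub>m k) $$ (f i, f l) * M $$ (f l, f j))"
      by (rule sum.reindex_bij_betw[OF f, symmetric])
    also have "\<dots> = (\<Sum>l\<in>{0..<n}. (M ^\<^sub>m k) $$ (i, l) * M $$ (l, j))"
      using Suc inv by (intro sum.cong) auto
    also have "\<dots> = (M ^\<^sub>m Suc k) $$ (i, j)"
      using Suc.prems by (simp only: mult_entry)
    finally show ?case .
  qed
qed

text \<open>The series defining the two entries agree term by term.\<close>

lemma mat_exp_bij_invariant:
  assumes M: "M \<in> carrier_mat n n" and f: "bij_betw f {0..<n} {0..<n}"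
    and inv: "\<And>i j. i < n \<Longrightarrow> j < n \<Longrightarrow> M $$ (f i, f j) = M $$ (i, j)"
    and ij: "i < n" "j < n"
  shows "mat_exp M $$ (f i, f j) = mat_exp M $$ (i, j)"
proof -
  have "f i < n" "f j < n"
    using bij_betwE[OF f] ij by simp_all
  then show ?thesis
    using M ij by (simp add: mat_exp_def pow_mat_bij_invariant[OF M f inv])
qed

lemma evolution_carrier: "evolution n t \<in> carrier_mat n n"
  by (simp add: evolution_def mat_exp_def unitary_cayley_matrix_def)

lemma evolution_reflection:
  assumes "i < n" "j < n"
  shows "evolution n t $$ (reflection n u i, reflection n u j) = evolution n t $$ (i, j)"
  unfolding evolution_def
proof (rule mat_exp_bij_invariant[OF _ bij_betw_reflection _ assms])
  show "(- \<i> * complex_of_real t) \<cdot>\<^sub>m unitary_cayley_matrix n \<in> carrier_mat n n"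
    by (simp add: unitary_cayley_matrix_def)
qed (simp add: unitary_cayley_matrix_def unitary_cayley_adj_reflection reflection_less)

theorem theorem1:
  fixes n :: nat
  assumes "odd n"
  shows "\<not> (\<exists>u v :: nat. \<exists>t :: real.
           u < n \<and> v < n \<and> u \<noteq> v \<and> t > 0 \<and> fractional_revival n u v t)"
proof
  assume "\<exists>u v :: nat. \<exists>t :: real.
           u < n \<and> v < n \<and> u \<noteq> v \<and> t > 0 \<and> fractional_revival n u v t"
  then obtain u v t \<alpha> \<beta> where uv: "u < n" "v < n" "u \<noteq> v" and \<beta>: "\<beta> \<noteq> 0"
    and eq: "evolution n t *\<^sub>v unit_vec n u = \<alpha> \<cdot>\<^sub>v unit_vec n u + \<beta> \<cdot>\<^sub>v unit_vec n v"
    unfolding fractional_revival_def by blast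
  define w where "w = reflection n u v"
  \<comment> \<open>If \<open>w = u\<close>, reflecting once more would give \<open>v = u\<close>,
    as \<open>u\<close> is fixed. That \<open>w \<noteq> v\<close> is where oddness enters.\<close>
  have w: "w < n" "w \<noteq> v" "w \<noteq> u"
    using uv reflection_less[of n u v] reflection_neq[OF assms uv]
      reflection_reflection[OF uv(2), of u] reflection_center[OF uv(1)]
    by (auto simp: w_def)
  have entry: "evolution n t $$ (i, u) = \<alpha> * (if i = u then 1 else 0) + \<beta> * (if i = v then 1 else 0)"
    if "i < n" for i
  proof -
    have "evolution n t $$ (i, u) = (evolution n t *\<^sub>v unit_vec n u) $ i"
      using that uv evolution_carrier[of n t] by simp
    also have "\<dots> = (\<alpha> \<cdot>\<^sub>v unit_vec n u + \<beta> \<cdot>\<^sub>v unit_vec n v) $ i"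
      by (simp only: eq)
    finally show ?thesis using that uv by simp
  qed
  have "\<beta> = evolution n t $$ (v, u)"
    using entry[OF uv(2)] uv by simp
  \<comment> \<open>The column index stays \<open>u\<close> because the reflection is centred at
    \<open>u\<close>.\<close>
  also have "\<dots> = evolution n t $$ (w, u)"
    using evolution_reflection[OF uv(2,1), of t u] uv by (simp add: w_def reflection_center)
  also have "\<dots> = 0"
    using entry[OF w(1)] w by simp
  finally show False using \<beta> by contradiction
qed

end
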